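(* Let $d$ be a positive integer, let $\mathbb{N}_+=\{1,2,3,\dots\}$, let $\{X_{\mathbf{n}},\ \mathbf{n}\in\mathbb{N}_+^d\}$ be a field of real random variables on a probability space $(\Omega,\mathcal{F},\mathbb{P})$, and let $r>1$. Assume there exists $C>0$ such that for every $\mathbf{m}\in\mathbb{N}_+^d$ and every $\varepsilon>0$ $$\mathbb{P}\Big(\max_{\boldsymbol{\ell}\le\mathbf{m}}\Big|\sum_{\mathbf{k}\le\boldsymbol{\ell}}\frac{X_{\mathbf{k}}}{\langle\mathbf{k}\rangle}\Big|\ge\varepsilon\Big)\le C\,\varepsilon^{-r}\sum_{\boldsymbol{\ell}\le\mathbf{m}}\frac{1}{\langle\boldsymbol{\ell}\rangle}.$$ Then $$\frac{1}{|\log\mathbf{n}|}\sum_{\mathbf{k}\le\mathbf{n}}\frac{X_{\mathbf{k}}}{\langle\mathbf{k}\rangle}\longrightarrow 0\quad\text{as }\mathbf{n}\to\infty,\ \text{almost surely.}$$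
   Context: All multi-indices range over $\mathbb{N}_+^d$, ordered coordinatewise: $\mathbf{m}\le\mathbf{n}$ iff $m_i\le n_i$ for all $1\le i\le d$. For $\mathbf{n}=(n_1,\dots,n_d)$, $\langle\mathbf{n}\rangle=\prod_{i=1}^d n_i$ and $|\log\mathbf{n}|=\prod_{i=1}^d\log^+ n_i$, where $\log^+(x)=\max(1,\log x)$ for $x>0$. The limit $\mathbf{n}\to\infty$ means $n_i\to+\infty$ for each $1\le i\le d$. *)

theory Defs
  imports "HOL-Probability.Probability"
begin

text \<open>
  Multi-indices are vectors of type \<^typ>\<open>nat ^ 'd\<close> with the componentwise order of the library;
  \<open>1\<close> is the all-ones vector, so \<open>1 \<le> n\<close> says that all components of \<open>n\<close> are positive, and
  \<open>{1..n}\<close> is the finite box of positive multi-indices below \<open>n\<close>.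
\<close>

lemma mem_box_iff:
  fixes k n :: "nat ^ 'd::finite"
  shows "k \<in> {1..n} \<longleftrightarrow> (\<forall>i. 1 \<le> k $ i \<and> k $ i \<le> n $ i)"
  by (auto simp: less_eq_vec_def)

lemma finite_box:
  fixes n :: "nat ^ 'd::finite"
  shows "finite {1..n}"
proof -
  have "{1..n} \<subseteq> vec_lambda ` (UNIV \<rightarrow>\<^sub>E {..Max (range (($) n))})"
  proof
    fix k assume k: "k \<in> {1..n}"
    have "k $ i \<le> Max (range (($) n))" for i
    proof -
      have "k $ i \<le> n $ i"
        using k unfolding mem_box_iff by blast
      also have "n $ i \<le> Max (range (($) n))"
        by (intro Max_ge) auto
      finally show ?thesis .
    qed
    then have "($) k \<in> UNIV \<rightarrow>\<^sub>E {..Max (range (($) n))}"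
      by auto
    then show "k \<in> vec_lambda ` (UNIV \<rightarrow>\<^sub>E {..Max (range (($) n))})"
      by (metis image_eqI vec_lambda_eta)
  qed
  moreover have "finite ((UNIV :: 'd set) \<rightarrow>\<^sub>E {..Max (range (($) n))})"
    by (intro finite_PiE) auto
  ultimately show ?thesis
    using finite_surj by blast
qed

definition index_prod :: "nat ^ 'd::finite \<Rightarrow> real" where
  "index_prod n = (\<Prod>i\<in>UNIV. real (n $ i))"

definition log_plus :: "real \<Rightarrow> real" where
  "log_plus x = max 1 (ln x)"

definition index_log :: "nat ^ 'd::finite \<Rightarrow> real" where
  "index_log n = (\<Prod>i\<in>UNIV. log_plus (real (n $ i)))"

definition log_sum :: "(nat ^ 'd::finite \<Rightarrow> 'a \<Rightarrow> real) \<Rightarrow> nat ^ 'd \<Rightarrow> 'a \<Rightarrow> real" where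
  "log_sum X n \<omega> = (\<Sum>k\<in>{1..n}. X k \<omega> / index_prod k)"

text \<open>The coarsest filter along which every component tends to infinity.\<close>

definition coords_at_top :: "(nat ^ 'd::finite) filter" where
  "coords_at_top = (INF i. filtercomap (\<lambda>n. n $ i) at_top)"

lemma eventually_coords_at_top:
  "eventually P (coords_at_top :: (nat ^ 'd::finite) filter) \<longleftrightarrow>
    (\<exists>N. \<forall>n. (\<forall>i. N \<le> n $ i) \<longrightarrow> P n)"
proof
  assume "eventually P (coords_at_top :: (nat ^ 'd) filter)"
  then obtain Q :: "'d \<Rightarrow> nat ^ 'd \<Rightarrow> bool" where
    Q: "\<And>i. eventually (Q i) (filtercomap (\<lambda>n. n $ i) at_top)"
    and P: "\<And>n. (\<forall>i. Q i n) \<Longrightarrow> P n"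
    unfolding coords_at_top_def eventually_INF_finite[OF finite] by auto
  from Q have "\<exists>N. \<forall>n. N \<le> n $ i \<longrightarrow> Q i n" for i
    unfolding eventually_filtercomap eventually_at_top_linorder by meson
  then obtain N where N: "\<And>i n. N i \<le> n $ i \<Longrightarrow> Q i n"
    by metis
  have "P n" if "\<forall>i. Max (range N) \<le> n $ i" for n
  proof (intro P allI N)
    fix i
    have "N i \<le> Max (range N)"
      by (intro Max_ge) auto
    with that show "N i \<le> n $ i"
      using order_trans by blast
  qed
  then show "\<exists>N. \<forall>n. (\<forall>i. N \<le> n $ i) \<longrightarrow> P n"
    by blast
next
  assume "\<exists>N. \<forall>n. (\<forall>i. N \<le> n $ i) \<longrightarrow> P n"
  then obtain N where N: "\<And>n. (\<forall>i. N \<le> n $ i) \<Longrightarrow> P n"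
    by blast
  have "eventually (\<lambda>n :: nat ^ 'd. N \<le> n $ i) (filtercomap (\<lambda>n. n $ i) at_top)" for i
    by (intro eventually_filtercomapI eventually_ge_at_top)
  then show "eventually P (coords_at_top :: (nat ^ 'd) filter)"
    unfolding coords_at_top_def eventually_INF_finite[OF finite]
    using N by (intro exI[of _ "\<lambda>i n. N \<le> n $ i"]) auto
qed

end

theory Submission
  imports Defs
begin

text \<open>
  Cut each axis at the points where \<open>log\<^sup>+\<close> crosses powers of two. The block with label \<open>a\<close>,
  on which \<open>2 ^ a\<^sub>i \<le> log\<^sup>+ n\<^sub>i \<le> 2 ^ (a\<^sub>i + 1)\<close>, lies in a box whose weight
  \<open>\<Sum> 1 / \<langle>l\<rangle>\<close> is \<open>O(\<Prod> 2 ^ a\<^sub>i)\<close>, so the maximal inequality with threshold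
  \<open>\<epsilon> \<Prod> 2 ^ a\<^sub>i\<close> gives a probability \<open>O(\<Prod> 2 ^ (- (r - 1) a\<^sub>i))\<close>. This is summable over the
  labels because \<open>r > 1\<close>, and the Borel-Cantelli lemma leaves only finitely many bad blocks.
\<close>

section \<open>Borel-Cantelli over a countable index set\<close>

lemma (in finite_measure) borel_cantelli_AE_countable:
  fixes A :: "'i::countable \<Rightarrow> 'a set"
  assumes sets: "\<And>i. A i \<in> sets M"
    and summable: "(\<lambda>i. measure M (A i)) summable_on UNIV"
  shows "AE x in M. finite {i. x \<in> A i}"
proof -
  \<comment> \<open>The family is moved to natural-number indices along \<open>to_nat\<close>.
    Indices outside the range get the empty set, which adds nothing to the series, so the sequential
    Borel-Cantelli lemma applies.\<close>
  define B where "B n = (if n \<in> range (to_nat :: 'i \<Rightarrow> nat) then A (from_nat n) else {})" for n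
  have B_to_nat: "B (to_nat i) = A i" for i
    by (simp add: B_def)
  have "(\<lambda>n. measure M (B n)) summable_on range (to_nat :: 'i \<Rightarrow> nat)"
    using summable by (subst summable_on_reindex) (auto simp: o_def B_to_nat)
  then have "(\<lambda>n. measure M (B n)) summable_on UNIV"
    by (rule summable_on_cong_neutral[THEN iffD1, rotated -1]) (auto simp: B_def)
  then have "summable (\<lambda>n. measure M (B n))"
    by (rule summable_on_imp_summable)
  moreover have "B n \<in> sets M" for n
    using sets by (simp add: B_def)
  ultimately have "AE x in M. eventually (\<lambda>n. x \<in> space M - B n) sequentially"
    by (intro borel_cantelli_AE1) (auto simp: less_top[symmetric])
  then show ?thesis
  proof (rule AE_mp, intro AE_I2 impI)
    fix x assume "eventually (\<lambda>n. x \<in> space M - B n) sequentially"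
    then obtain N where N: "\<And>n. n \<ge> N \<Longrightarrow> x \<notin> B n"
      by (auto simp: eventually_sequentially)
    have "to_nat ` {i. x \<in> A i} \<subseteq> {..<N}"
      using N by (auto simp: B_to_nat[symmetric] not_le[symmetric])
    then have "finite (to_nat ` {i. x \<in> A i})"
      using finite_subset by blast
    then show "finite {i. x \<in> A i}"
      by (rule finite_imageD) (auto intro: inj_onI)
  qed
qed

section \<open>Sums over multi-indices that factor over the coordinates\<close>

lemma sum_vec_prod:
  fixes f :: "'d::finite \<Rightarrow> 'b \<Rightarrow> 'c::comm_semiring_1"
  assumes "\<And>i. finite (B i)"
  shows "(\<Sum>v\<in>{v. \<forall>i. v $ i \<in> B i}. \<Prod>i\<in>UNIV. f i (v $ i)) = (\<Prod>i\<in>UNIV. \<Sum>j\<in>B i. f i j)"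
proof -
  have "(\<Prod>i\<in>UNIV. \<Sum>j\<in>B i. f i j) = (\<Sum>g\<in>PiE UNIV B. \<Prod>i\<in>UNIV. f i (g i))"
    using assms by (intro prod_sum_PiE) auto
  also have "\<dots> = (\<Sum>v\<in>{v. \<forall>i. v $ i \<in> B i}. \<Prod>i\<in>UNIV. f i (v $ i))"
    by (rule sum.reindex_bij_witness[of _ "vec_nth" "vec_lambda"]) auto
  finally show ?thesis by simp
qed

lemma finite_vec_box:
  fixes B :: "'d::finite \<Rightarrow> 'b set"
  assumes "\<And>i. finite (B i)"
  shows "finite {v. \<forall>i. v $ i \<in> B i}"
proof -
  have "{v. \<forall>i. v $ i \<in> B i} = vec_lambda ` PiE UNIV B"
    by (auto simp: image_iff intro!: bexI[of _ "vec_nth _"])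
  then show ?thesis
    using assms by (simp add: finite_PiE)
qed

text \<open>Any finite set of vectors lies in a cube \<open>{..K}\<close> to the power d. Over the
  cube the sum factors into partial sums of \<open>f\<close>, each at most \<open>suminf f\<close>,
  which bounds all finite partial sums at once.\<close>

lemma summable_on_vec_prod:
  fixes f :: "nat \<Rightarrow> real"
  assumes nonneg: "\<And>j. f j \<ge> 0" and "summable f"
  shows "(\<lambda>v :: nat ^ 'd::finite. \<Prod>i\<in>UNIV. f (v $ i)) summable_on UNIV"
proof (rule nonneg_bounded_partial_sums_imp_summable_on)
  show "eventually (\<lambda>F. (\<Sum>v\<in>F. \<Prod>i\<in>UNIV. f (v $ i)) \<le> (\<Prod>i\<in>(UNIV :: 'd set). suminf f))
    (finite_subsets_at_top (UNIV :: (nat ^ 'd) set))"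
  proof (intro eventually_finite_subsets_at_top_weakI)
    fix F :: "(nat ^ 'd) set" assume F: "finite F"
    define K where "K = Max (insert 0 ((\<lambda>(v, i). v $ i) ` (F \<times> UNIV)))"
    have "v $ i \<le> K" if "v \<in> F" for v i
      unfolding K_def using F that by (intro Max_ge) auto
    then have "(\<Sum>v\<in>F. \<Prod>i\<in>UNIV. f (v $ i)) \<le>
        (\<Sum>v\<in>{v :: nat ^ 'd. \<forall>i. v $ i \<in> {..K}}. \<Prod>i\<in>UNIV. f (v $ i))"
      using nonneg by (intro sum_mono2 finite_vec_box) (auto intro: prod_nonneg)
    also have "\<dots> = (\<Prod>i\<in>(UNIV :: 'd set). \<Sum>j\<in>{..K}. f j)"
      by (rule sum_vec_prod) auto
    also have "\<dots> \<le> (\<Prod>i\<in>(UNIV :: 'd set). suminf f)"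
      using assms by (intro prod_mono conjI sum_nonneg sum_le_suminf) auto
    finally show "(\<Sum>v\<in>F. \<Prod>i\<in>UNIV. f (v $ i)) \<le> (\<Prod>i\<in>(UNIV :: 'd set). suminf f)" .
  qed
qed (use nonneg in \<open>auto intro: prod_nonneg\<close>)

section \<open>Harmonic weights and dyadic blocks on the logarithmic scale\<close>

lemma sum_inverse_index_prod:
  fixes m :: "nat ^ 'd::finite"
  shows "(\<Sum>l\<in>{1..m}. 1 / index_prod l) = (\<Prod>i\<in>UNIV. harm (m $ i))"
proof -
  have "{1..m} = {l. \<forall>i. l $ i \<in> {1..m $ i}}"
    unfolding set_eq_iff mem_box_iff by simp
  moreover have "1 / index_prod l = (\<Prod>i\<in>UNIV. 1 / real (l $ i))" for l :: "nat ^ 'd"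
    by (simp add: index_prod_def prod_dividef)
  ultimately show ?thesis
    using sum_vec_prod[of "\<lambda>i. {1..m $ i}" "\<lambda>_ j. 1 / real j"]
    by (simp add: harm_def inverse_eq_divide)
qed

text \<open>The sequence \<open>harm n - ln n\<close> decreases from its value 1 at
  \<open>n = 1\<close>, so \<open>harm n\<close> is at most \<open>1 + ln n\<close>, and both
  summands are at most \<open>log_plus n\<close>.\<close>

lemma harm_le_log_plus:
  assumes "n \<ge> 1"
  shows "harm n \<le> 2 * log_plus (real n)"
  using euler_mascheroni_sequence_decreasing[of 1 n] assms
  by (simp add: log_plus_def harm_expand)

lemma log_plus_ge_1: "log_plus x \<ge> 1"
  by (simp add: log_plus_def)

lemma log_plus_le_iff:
  assumes "x > 0" "y \<ge> 1"
  shows "log_plus x \<le> y \<longleftrightarrow> x \<le> exp y"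
  using assms ln_le_cancel_iff[of x "exp y"] by (simp add: log_plus_def)

lemma ex_dyadic_bracket:
  fixes y :: real
  assumes "y \<ge> 1"
  obtains a :: nat where "2 ^ a \<le> y" "y \<le> 2 ^ Suc a"
proof -
  define a where "a = nat \<lfloor>log 2 y\<rfloor>"
  have "log 2 y \<ge> 0"
    using assms by simp
  then have "real a = of_int \<lfloor>log 2 y\<rfloor>"
    by (simp add: a_def)
  then have "real a \<le> log 2 y" "log 2 y \<le> real (Suc a)"
    by linarith+
  then show thesis
    using assms that[of a] by (auto simp: le_log_iff log_le_iff powr_realpow simp del: power_Suc of_nat_Suc)
qed

text \<open>The largest multi-index all of whose coordinates have \<open>log_plus\<close> at most
  \<open>2 ^ Suc (a $ i)\<close>, that is, the upper corner of the block with label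
  \<open>a\<close>.\<close>

definition block_top :: "nat ^ 'd::finite \<Rightarrow> nat ^ 'd" where
  "block_top a = (\<chi> i. nat \<lfloor>exp (2 ^ Suc (a $ i) :: real)\<rfloor>)"

lemma le_block_top_iff:
  assumes "n $ i \<ge> 1"
  shows "n $ i \<le> block_top a $ i \<longleftrightarrow> log_plus (real (n $ i)) \<le> 2 ^ Suc (a $ i)"
proof -
  have "(1::real) \<le> 2 ^ Suc (a $ i)"
    by (rule one_le_power) simp
  then have "log_plus (real (n $ i)) \<le> 2 ^ Suc (a $ i) \<longleftrightarrow> real (n $ i) \<le> exp (2 ^ Suc (a $ i))"
    using assms by (intro log_plus_le_iff) auto
  then show ?thesis
    by (simp add: block_top_def le_nat_iff le_floor_iff del: power_Suc)
qed

lemma block_top_ge_1: "1 \<le> block_top a"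
  by (auto simp: less_eq_vec_def block_top_def le_nat_iff le_floor_iff)

text \<open>Each coordinate contributes a factor 4: one 2 comes from
  \<open>harm_le_log_plus\<close>, the other from the upper end of a block being twice its lower
  end.\<close>

lemma sum_inverse_index_prod_block_top:
  fixes a :: "nat ^ 'd::finite"
  shows "(\<Sum>l\<in>{1..block_top a}. 1 / index_prod l) \<le> 4 ^ CARD('d) * (\<Prod>i\<in>UNIV. 2 ^ (a $ i))"
proof -
  have "harm (block_top a $ i) \<le> (4 * 2 ^ (a $ i) :: real)" for i
  proof -
    have "block_top a $ i \<ge> 1"
      using block_top_ge_1[of a] by (auto simp: less_eq_vec_def)
    with harm_le_log_plus[OF this] le_block_top_iff[of "block_top a" i a] show ?thesis
      by simp
  qed
  then have "(\<Prod>i\<in>UNIV. harm (block_top a $ i)) \<le> (\<Prod>i\<in>(UNIV :: 'd set). 4 * 2 ^ (a $ i) :: real)"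
    by (intro prod_mono) (auto simp: harm_nonneg)
  then show ?thesis
    by (simp add: sum_inverse_index_prod prod.distrib)
qed

section \<open>Almost sure bound for a fixed threshold\<close>

lemma AE_eventually_log_sum_less:
  fixes M :: "'a measure"
    and X :: "nat ^ 'd::finite \<Rightarrow> 'a \<Rightarrow> real"
  assumes "prob_space M"
    and X [measurable]: "\<And>k. 1 \<le> k \<Longrightarrow> X k \<in> borel_measurable M"
    and r: "r > 1"
    and C: "C > 0" "\<And>m \<epsilon>. m \<ge> 1 \<Longrightarrow> \<epsilon> > 0 \<Longrightarrow>
           measure M {\<omega> \<in> space M. Max ((\<lambda>l. \<bar>log_sum X l \<omega>\<bar>) ` {1..m}) \<ge> \<epsilon>}
             \<le> C * \<epsilon> powr (- r) * (\<Sum>l\<in>{1..m}. 1 / index_prod l)"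
    and \<epsilon>: "\<epsilon> > 0"
  shows "AE \<omega> in M. eventually (\<lambda>n. \<bar>log_sum X n \<omega>\<bar> < \<epsilon> * index_log n) coords_at_top"
proof -
  interpret prob_space M by fact
  \<comment> \<open>\<open>T a\<close> is the lower bound of \<open>index_log\<close> on block
    \<open>a\<close>, and \<open>A a\<close> is the bad event there. The weight of the box is
    O(\<open>T a\<close>), so the estimate for \<open>A a\<close> is
    O(\<open>T a powr (1 - r)\<close>), a product of powers of \<open>q\<close>.\<close>
  define T :: "nat ^ 'd \<Rightarrow> real" where "T a = (\<Prod>i\<in>UNIV. 2 ^ (a $ i))" for a
  define A where
    "A a = {\<omega> \<in> space M. Max ((\<lambda>l. \<bar>log_sum X l \<omega>\<bar>) ` {1..block_top a}) \<ge> \<epsilon> * T a}" for a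
  define q :: real where "q = 2 powr (1 - r)"
  have T_pos: "T a > 0" for a
    by (auto simp: T_def intro: prod_pos)
  \<comment> \<open>The box is finite and contains 1, so its \<open>Max\<close> is attained and the
    event is a finite union.\<close>
  have A_iff: "\<omega> \<in> A a \<longleftrightarrow> \<omega> \<in> space M \<and> (\<exists>l\<in>{1..block_top a}. \<epsilon> * T a \<le> \<bar>log_sum X l \<omega>\<bar>)" for a \<omega>
    unfolding A_def using block_top_ge_1[of a] finite_box[of "block_top a"]
    by (simp add: Max_ge_iff)
  have log_sum_measurable: "log_sum X l \<in> borel_measurable M" for l
    unfolding log_sum_def by measurable
  have sets: "A a \<in> sets M" for a
  proof -
    have "A a = (\<Union>l\<in>{1..block_top a}. {\<omega> \<in> space M. \<epsilon> * T a \<le> \<bar>log_sum X l \<omega>\<bar>})"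
      using A_iff by auto
    also have "\<dots> \<in> sets M"
      using log_sum_measurable by (intro sets.finite_UN finite_box) measurable
    finally show ?thesis .
  qed
  have bound: "measure M (A a) \<le> C * \<epsilon> powr (- r) * 4 ^ CARD('d) * (\<Prod>i\<in>UNIV. q ^ (a $ i))" for a
  proof -
    have "measure M (A a) \<le> C * (\<epsilon> * T a) powr (- r) * (\<Sum>l\<in>{1..block_top a}. 1 / index_prod l)"
      unfolding A_def using \<epsilon> T_pos by (intro C block_top_ge_1) auto
    also have "\<dots> \<le> C * (\<epsilon> * T a) powr (- r) * (4 ^ CARD('d) * T a)"
      using C(1) sum_inverse_index_prod_block_top[of a]
      by (intro mult_left_mono) (auto simp: T_def)
    also have "\<dots> = C * \<epsilon> powr (- r) * 4 ^ CARD('d) * (T a powr (- r) * T a powr 1)"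
      using \<epsilon> T_pos[of a] by (simp add: powr_mult)
    also have "T a powr (- r) * T a powr 1 = T a powr (1 - r)"
      unfolding powr_add[symmetric] by simp
    also have "\<dots> = (\<Prod>i\<in>UNIV. q ^ (a $ i))"
      unfolding T_def q_def
      by (subst prod_powr_distrib) (auto simp: powr_realpow[symmetric] powr_powr mult.commute)
    finally show ?thesis .
  qed
  \<comment> \<open>This is where \<open>r > 1\<close> enters: it makes
    \<open>q < 1\<close>.\<close>
  have "summable (\<lambda>n. q ^ n)"
    using r powr_less_mono[of "1 - r" 0 2] by (intro summable_geometric) (simp add: q_def)
  then have "(\<lambda>a :: nat ^ 'd. \<Prod>i\<in>UNIV. q ^ (a $ i)) summable_on UNIV"
    by (intro summable_on_vec_prod) (auto simp: q_def)
  then have "(\<lambda>a :: nat ^ 'd. C * \<epsilon> powr (- r) * 4 ^ CARD('d) * (\<Prod>i\<in>UNIV. q ^ (a $ i))) summable_on UNIV"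
    by (rule summable_on_cmult_right)
  then have "(\<lambda>a. measure M (A a)) summable_on UNIV"
    by (rule summable_on_comparison_test) (use bound in auto)
  with sets have "AE \<omega> in M. finite {a. \<omega> \<in> A a}"
    by (rule borel_cantelli_AE_countable)
  then show ?thesis
  proof (rule AE_mp, intro AE_I2 impI)
    fix \<omega> assume \<omega>: "\<omega> \<in> space M" and fin: "finite {a. \<omega> \<in> A a}"
    \<comment> \<open>One arbitrary coordinate suffices: the finitely many bad labels have
      \<open>j\<close>-th entries at most \<open>K\<close>, so a label whose \<open>j\<close>-th
      entry exceeds \<open>K\<close> is good, whatever its other entries are. The inserted 0 covers
      the case of no bad label.\<close>
    fix j :: 'd
    define K where "K = Max (insert 0 ((\<lambda>a. a $ j) ` {a. \<omega> \<in> A a}))"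
    have K: "a $ j \<le> K" if "\<omega> \<in> A a" for a
      unfolding K_def using fin that by (intro Max_ge) auto
    obtain N :: nat where N: "exp (2 ^ Suc K) < real N"
      using reals_Archimedean2 by blast
    show "eventually (\<lambda>n. \<bar>log_sum X n \<omega>\<bar> < \<epsilon> * index_log n) coords_at_top"
      unfolding eventually_coords_at_top
    proof (intro exI allI impI)
      \<comment> \<open>The bound \<open>N\<close> is needed only at \<open>j\<close>; the 1 in the
        maximum makes every coordinate positive, as membership in a box requires.\<close>
      fix n :: "nat ^ 'd" assume n: "\<forall>i. max 1 N \<le> n $ i"
      have "\<exists>a. 2 ^ a \<le> log_plus (real (n $ i)) \<and> log_plus (real (n $ i)) \<le> 2 ^ Suc a" for i
        using ex_dyadic_bracket[OF log_plus_ge_1] by metis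
      then obtain f where f: "\<And>i. 2 ^ f i \<le> log_plus (real (n $ i))"
        "\<And>i. log_plus (real (n $ i)) \<le> 2 ^ Suc (f i)"
        by metis
      define a :: "nat ^ 'd" where "a = vec_lambda f"
      have "\<not> real (n $ j) \<le> exp (2 ^ Suc K)"
        using N n by (auto simp: not_le elim!: less_le_trans)
      then have "\<not> log_plus (real (n $ j)) \<le> 2 ^ Suc K"
        using n by (subst log_plus_le_iff) (auto simp: Suc_le_eq intro: one_le_power simp del: power_Suc)
      \<comment> \<open>The upper end of the dyadic bracket gives \<open>K < f j\<close>, so the
        block containing \<open>n\<close> is good. The lower end serves below, to compare
        \<open>T a\<close> with \<open>index_log n\<close>.\<close>
      then have "(2::real) ^ Suc K < 2 ^ Suc (f j)"
        using f(2)[of j] by linarith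
      then have "\<omega> \<notin> A a"
        using K[of a] by (auto simp: a_def)
      moreover have "n \<in> {1..block_top a}"
        using n f(2) le_block_top_iff[of n _ a] by (auto simp: less_eq_vec_def a_def simp del: power_Suc)
      ultimately have "\<bar>log_sum X n \<omega>\<bar> < \<epsilon> * T a"
        using \<omega> by (auto simp: A_iff not_le[symmetric])
      also have "\<epsilon> * T a \<le> \<epsilon> * index_log n"
        unfolding T_def index_log_def using \<epsilon> f(1)
        by (intro mult_left_mono prod_mono) (auto simp: a_def)
      finally show "\<bar>log_sum X n \<omega>\<bar> < \<epsilon> * index_log n" .
    qed
  qed
qed

lemma index_log_pos: "index_log n > 0"
  unfolding index_log_def by (intro prod_pos) (auto intro: less_le_trans[OF zero_less_one log_plus_ge_1])

theorem theorem5: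
  fixes M :: "'a measure"
    and X :: "nat ^ 'd::finite \<Rightarrow> 'a \<Rightarrow> real"
    and r :: real
  assumes "prob_space M"
    and "\<And>k. 1 \<le> k \<Longrightarrow> X k \<in> borel_measurable M"
    and "r > 1"
    and "\<exists>C>0. \<forall>m\<ge>1. \<forall>\<epsilon>>0.
           measure M {\<omega> \<in> space M. Max ((\<lambda>l. \<bar>log_sum X l \<omega>\<bar>) ` {1..m}) \<ge> \<epsilon>}
             \<le> C * \<epsilon> powr (- r) * (\<Sum>l\<in>{1..m}. 1 / index_prod l)"
  shows "AE \<omega> in M. ((\<lambda>n. 1 / index_log n * log_sum X n \<omega>) \<longlongrightarrow> 0) coords_at_top"
proof -
  obtain C where C: "C > 0" "\<And>m \<epsilon>. m \<ge> 1 \<Longrightarrow> \<epsilon> > 0 \<Longrightarrow>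
           measure M {\<omega> \<in> space M. Max ((\<lambda>l. \<bar>log_sum X l \<omega>\<bar>) ` {1..m}) \<ge> \<epsilon>}
             \<le> C * \<epsilon> powr (- r) * (\<Sum>l\<in>{1..m}. 1 / index_prod l)"
    using assms(4) by blast
  \<comment> \<open>The exceptional null set depends on the threshold. The values 1/(p+1) are
    countably many, so one null set serves for all of them, and they fall below every positive
    \<open>e\<close>.\<close>
  have "AE \<omega> in M. \<forall>p::nat. eventually
      (\<lambda>n. \<bar>log_sum X n \<omega>\<bar> < inverse (real (Suc p)) * index_log n) coords_at_top"
    unfolding AE_all_countable
    by (intro allI AE_eventually_log_sum_less[OF assms(1) assms(2) assms(3) C]) auto
  then show ?thesis
  proof (rule AE_mp, intro AE_I2 impI tendstoI)
    fix \<omega> and e :: real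
    assume *: "\<forall>p::nat. eventually
      (\<lambda>n. \<bar>log_sum X n \<omega>\<bar> < inverse (real (Suc p)) * index_log n) coords_at_top"
    assume "e > 0"
    then obtain p where p: "inverse (real (Suc p)) < e"
      using reals_Archimedean by blast
    from * have "eventually
      (\<lambda>n. \<bar>log_sum X n \<omega>\<bar> < inverse (real (Suc p)) * index_log n) coords_at_top"
      by blast
    then show "eventually (\<lambda>n. dist (1 / index_log n * log_sum X n \<omega>) 0 < e) coords_at_top"
    proof (rule eventually_mono)
      fix n assume "\<bar>log_sum X n \<omega>\<bar> < inverse (real (Suc p)) * index_log n"
      also have "\<dots> \<le> e * index_log n"
        using p index_log_pos[of n] by (intro mult_right_mono) auto
      finally show "dist (1 / index_log n * log_sum X n \<omega>) 0 < e"
        using index_log_pos[of n] by (simp add: abs_mult pos_divide_less_eq)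
    qed
  qed
qed

end
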